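(* Let $\ell\geqslant 1$ and $h\geqslant 0$ be integers, and let $\Gamma$ be an abelian group of order $16(2\ell+1)(2h+1)$. An $\mathrm{MRS}_\Gamma(2\ell+1, 8; 4h+2)$ exists if and only if $\Gamma$ has more than one involution.
   Context: For an abelian group $(\Gamma,+)$ of order $abc$, a $\Gamma$-magic rectangle set $\mathrm{MRS}_\Gamma(a,b;c)$ is a collection of $c$ arrays of size $a\times b$ whose entries are the elements of $\Gamma$, each element appearing exactly once and in a unique array, such that there are $\omega,\delta\in\Gamma$ with the sum of the entries of every row (of every array) equal to $\omega$ and the sum of the entries of every column (of every array) equal to $\delta$. An involution is an element of order $2$. *)

theory Defs
  imports Main
begin

text \<open>A magic rectangle set MRS(a,b;c) over a finite abelian group 'a (written additively):
  A k i j is the entry in row i, column j of array k (k < c, i < a, j < b).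
  Every group element occurs exactly once among all entries, all row sums equal
  some omega and all column sums equal some delta.\<close>

definition is_MRS :: "nat \<Rightarrow> nat \<Rightarrow> nat \<Rightarrow> (nat \<Rightarrow> nat \<Rightarrow> nat \<Rightarrow> 'a::ab_group_add) \<Rightarrow> bool" where
  "is_MRS a b c A \<longleftrightarrow>
     bij_betw (\<lambda>(k, i, j). A k i j) ({..<c} \<times> {..<a} \<times> {..<b}) (UNIV :: 'a set) \<and>
     (\<exists>\<omega> \<delta>. (\<forall>k<c. \<forall>i<a. (\<Sum>j<b. A k i j) = \<omega>) \<and>
            (\<forall>k<c. \<forall>j<b. (\<Sum>i<a. A k i j) = \<delta>))"

definition MRS_exists :: "'a::ab_group_add itself \<Rightarrow> nat \<Rightarrow> nat \<Rightarrow> nat \<Rightarrow> bool" where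
  "MRS_exists _ a b c \<longleftrightarrow> (\<exists>A :: nat \<Rightarrow> nat \<Rightarrow> nat \<Rightarrow> 'a. is_MRS a b c A)"

definition involutions :: "'a::ab_group_add set" where
  "involutions = {x. x \<noteq> 0 \<and> x + x = 0}"

end

theory Submission
  imports Defs "HOL-Library.Product_Plus" "HOL-Number_Theory.Cong"
begin

text \<open>
  If there is exactly one involution, it is the sum of all elements, hence \<open>16(2h + 1)\<delta>\<close>, which is
  killed by the odd number \<open>2l + 1\<close>; but an odd multiple of an involution is not \<open>0\<close>.

  Conversely, two involutions \<open>x, y\<close> span a Klein four-group \<open>V\<close>, which two applications of Cauchy's
  theorem extend to a subgroup \<open>P\<close> of order 16.  Let \<open>K\<close> be a subgroup of order \<open>2h + 1\<close>.  As \<open>P + K\<close>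
  has odd index, the group is the disjoint union of \<open>P + K\<close> and \<open>\<plusminus> u\<^sub>t + P + K\<close> for \<open>t < l\<close>.  Row \<open>0\<close> of
  the arrays is taken from \<open>P + K\<close> and the rows \<open>2t + 1, 2t + 2\<close> from \<open>\<plusminus> u\<^sub>t + P + K\<close>.  For \<open>t > 0\<close> these
  two rows are negatives of each other, so they cancel in the columns; they have row sum \<open>0\<close> because
  every coset of \<open>V\<close> has a balanced signed sum equal to \<open>0\<close>.  The first three rows come from three
  bijections onto \<open>P\<close> with sum \<open>0\<close>, combined with multiplication by \<open>\<plusminus> (1, 1, -2)\<close> on \<open>K\<close>.  The
  bijections depend on whether \<open>P / V\<close> is elementary abelian or cyclic.
\<close>

section \<open>Subgroups of finite abelian groups\<close>

primrec nmul :: "nat \<Rightarrow> 'a::ab_group_add \<Rightarrow> 'a" where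
  "nmul 0 x = 0"
| "nmul (Suc n) x = x + nmul n x"

lemma nmul_zero [simp]: "nmul n 0 = 0"
  by (induction n) auto

lemma nmul_add: "nmul (m + n) x = nmul m x + nmul n x"
  by (induction m) (auto simp: add.assoc)

lemma nmul_distrib: "nmul n (x + y) = nmul n x + nmul n y"
  by (induction n) (auto simp: algebra_simps)

lemma nmul_mult: "nmul (m * n) x = nmul m (nmul n x)"
  by (induction m) (auto simp: nmul_add)

lemma nmul_numeral [simp]: "nmul (numeral k) x = x + nmul (pred_numeral k) x"
  by (simp add: numeral_eq_Suc)

lemma sum_constant_nmul: "finite A \<Longrightarrow> (\<Sum>x\<in>A. c) = nmul (card A) c"
  by (induction A rule: finite_induct) auto

definition sgrp :: "'a::ab_group_add set \<Rightarrow> bool" where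
  "sgrp S \<longleftrightarrow> 0 \<in> S \<and> (\<forall>x\<in>S. \<forall>y\<in>S. x + y \<in> S) \<and> (\<forall>x\<in>S. - x \<in> S)"

lemma sgrp_zero: "sgrp S \<Longrightarrow> 0 \<in> S"
  and sgrp_add: "sgrp S \<Longrightarrow> x \<in> S \<Longrightarrow> y \<in> S \<Longrightarrow> x + y \<in> S"
  and sgrp_minus: "sgrp S \<Longrightarrow> x \<in> S \<Longrightarrow> - x \<in> S"
  by (auto simp: sgrp_def)

lemma sgrp_diff: "sgrp S \<Longrightarrow> x \<in> S \<Longrightarrow> y \<in> S \<Longrightarrow> x - y \<in> S"
  using sgrp_add[of S x "- y"] sgrp_minus[of S y] by simp

lemma sgrp_nmul: "sgrp S \<Longrightarrow> x \<in> S \<Longrightarrow> nmul n x \<in> S"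
  by (induction n) (auto simp: sgrp_zero sgrp_add)

lemma sgrp_add_cancel: "sgrp S \<Longrightarrow> x \<in> S \<Longrightarrow> x + y \<in> S \<longleftrightarrow> y \<in> S"
  using sgrp_add[of S x y] sgrp_diff[of S "x + y" x] by auto

text \<open>Translation by \<open>x\<close> permutes \<open>S\<close>, so the sum over
  \<open>S\<close> is unchanged although each summand gains \<open>x\<close>.\<close>

lemma nmul_card_sgrp:
  fixes S :: "'a::{ab_group_add, finite} set"
  assumes "sgrp S" "x \<in> S"
  shows "nmul (card S) x = 0"
proof -
  have "(\<Sum>s\<in>S. s) = (\<Sum>s\<in>S. x + s)"
    by (rule sum.reindex_bij_witness[where i = "\<lambda>s. x + s" and j = "\<lambda>s. s - x"])
      (use assms in \<open>auto simp: sgrp_add sgrp_diff\<close>)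
  also have "\<dots> = nmul (card S) x + (\<Sum>s\<in>S. s)"
    by (simp add: sum.distrib sum_constant_nmul)
  finally show ?thesis by simp
qed

definition setplus :: "'a::ab_group_add set \<Rightarrow> 'a set \<Rightarrow> 'a set" where
  "setplus S T = (\<lambda>(s, t). s + t) ` (S \<times> T)"

lemma setplusE:
  assumes "x \<in> setplus S T"
  obtains s t where "s \<in> S" "t \<in> T" "x = s + t"
  using assms by (auto simp: setplus_def)

lemma setplusI: "s \<in> S \<Longrightarrow> t \<in> T \<Longrightarrow> s + t \<in> setplus S T"
  by (auto simp: setplus_def)

lemma sgrp_setplus:
  assumes "sgrp S" "sgrp T"
  shows "sgrp (setplus S T)"
  unfolding sgrp_def
proof (intro conjI ballI)
  show "0 \<in> setplus S T"
    using setplusI[of 0 S 0 T] assms by (simp add: sgrp_zero)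
next
  fix x y assume "x \<in> setplus S T" "y \<in> setplus S T"
  then obtain s t s' t' where "s \<in> S" "t \<in> T" "x = s + t" "s' \<in> S" "t' \<in> T" "y = s' + t'"
    by (metis setplusE)
  then show "x + y \<in> setplus S T"
    using setplusI[of "s + s'" S "t + t'" T] assms by (simp add: sgrp_add algebra_simps)
next
  fix x assume "x \<in> setplus S T"
  then obtain s t where "s \<in> S" "t \<in> T" "x = s + t"
    by (metis setplusE)
  then show "- x \<in> setplus S T"
    using setplusI[of "- s" S "- t" T] assms by (simp add: sgrp_minus algebra_simps)
qed

lemma card_setplus:
  assumes "sgrp S" "sgrp T" "S \<inter> T \<subseteq> {0}"
  shows "card (setplus S T) = card S * card T"
proof -
  have "inj_on (\<lambda>(s, t). s + t) (S \<times> T)"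
  proof (rule inj_onI, clarify)
    fix s t s' t' assume *: "s \<in> S" "t \<in> T" "s' \<in> S" "t' \<in> T" "s + t = s' + t'"
    then have "s - s' = t' - t" by (simp add: algebra_simps)
    moreover have "s - s' \<in> S" "t' - t \<in> T" using * assms sgrp_diff by blast+
    ultimately have "s - s' = 0" "t' - t = 0" using assms(3) by auto
    then show "s = s' \<and> t = t'" by simp
  qed
  then show ?thesis
    unfolding setplus_def by (simp add: card_image card_cartesian_product)
qed

section \<open>Extending a subgroup by one element; the theorems of Lagrange and Cauchy\<close>

definition adjoin :: "'a::ab_group_add set \<Rightarrow> nat \<Rightarrow> 'a \<Rightarrow> 'a set" where
  "adjoin S r g = (\<lambda>(s, j). s + nmul j g) ` (S \<times> {..<r})"

lemma adjoinE:
  assumes "x \<in> adjoin S r g"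
  obtains s j where "s \<in> S" "j < r" "x = s + nmul j g"
  using assms by (auto simp: adjoin_def)

text \<open>The multiple \<open>j\<close> is unrestricted: reducing it modulo \<open>r\<close>
  leaves a multiple of \<open>nmul r g\<close>, which \<open>S\<close> absorbs.\<close>

lemma adjoinI:
  assumes "sgrp S" "nmul r g \<in> S" "r > 0" "s \<in> S" "x = s + nmul j g"
  shows "x \<in> adjoin S r g"
proof -
  have "nmul j g = nmul (j div r) (nmul r g) + nmul (j mod r) g"
    by (metis div_mult_mod_eq nmul_add nmul_mult)
  then have "x = (s + nmul (j div r) (nmul r g)) + nmul (j mod r) g"
    using assms by (simp add: add.assoc)
  moreover have "s + nmul (j div r) (nmul r g) \<in> S"
    using assms by (simp add: sgrp_add sgrp_nmul)
  ultimately show ?thesis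
    using \<open>r > 0\<close> unfolding adjoin_def by force
qed

lemma sgrp_adjoin:
  assumes "sgrp S" "nmul r g \<in> S" "r > 0"
  shows "sgrp (adjoin S r g)"
  unfolding sgrp_def
proof (intro conjI ballI)
  show "0 \<in> adjoin S r g"
    by (rule adjoinI[OF assms, of 0 _ 0]) (use assms in \<open>auto simp: sgrp_zero\<close>)
next
  fix x y assume "x \<in> adjoin S r g" "y \<in> adjoin S r g"
  then obtain s j s' j' where *: "s \<in> S" "x = s + nmul j g" "s' \<in> S" "y = s' + nmul j' g"
    by (metis adjoinE)
  show "x + y \<in> adjoin S r g"
    by (rule adjoinI[OF assms, of "s + s'" _ "j + j'"])
      (use * assms in \<open>auto simp: sgrp_add nmul_add algebra_simps\<close>)
next
  fix x assume "x \<in> adjoin S r g"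
  then obtain s j where *: "s \<in> S" "j < r" "x = s + nmul j g"
    by (metis adjoinE)
  have "nmul r g = nmul j g + nmul (r - j) g"
    using * by (metis nmul_add le_add_diff_inverse less_imp_le)
  then show "- x \<in> adjoin S r g"
    by (intro adjoinI[OF assms, of "- s - nmul r g" _ "r - j"])
      (use * assms in \<open>auto simp: sgrp_minus sgrp_diff algebra_simps\<close>)
qed

text \<open>If two representations agreed, the difference of their multiples of \<open>g\<close>
  would lie in \<open>S\<close>, against the minimality of \<open>r\<close>.\<close>

lemma card_adjoin:
  assumes "sgrp S" "nmul r g \<in> S" "\<And>j. 0 < j \<Longrightarrow> j < r \<Longrightarrow> nmul j g \<notin> S"
  shows "card (adjoin S r g) = r * card S"
proof -
  have aux: "j' \<le> j" if "s \<in> S" "s' \<in> S" "j < r" "j' < r" "s + nmul j g = s' + nmul j' g" for s s' j j'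
  proof (rule ccontr)
    assume "\<not> j' \<le> j"
    then obtain d where d: "j' = j + d" "d > 0"
      by (metis less_imp_add_positive not_le)
    then have "nmul d g = s - s'"
      using that by (simp add: nmul_add algebra_simps)
    then have "nmul d g \<in> S" using that assms sgrp_diff by metis
    then show False using assms(3)[of d] d that by auto
  qed
  have "inj_on (\<lambda>(s, j). s + nmul j g) (S \<times> {..<r})"
  proof (rule inj_onI, clarify)
    fix s j s' j' assume *: "s \<in> S" "s' \<in> S" "j < r" "j' < r" "s + nmul j g = s' + nmul j' g"
    then have "j = j'"
      using aux[of s s' j j'] aux[of s' s j' j] by auto
    then show "s = s' \<and> j = j'" using * by simp
  qed
  then show ?thesis
    unfolding adjoin_def by (simp add: card_image card_cartesian_product)
qed

lemma adjoin_mem: "sgrp S \<Longrightarrow> nmul r g \<in> S \<Longrightarrow> r > 0 \<Longrightarrow> g \<in> adjoin S r g"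
  by (rule adjoinI[of S r g 0 g 1]) (auto simp: sgrp_zero)

text \<open>This \<open>r\<close> is the order of \<open>g\<close> modulo \<open>S\<close>; it
  exists because the group order annihilates \<open>g\<close>.\<close>

lemma obtain_adjoin:
  fixes S :: "'a::{ab_group_add, finite} set"
  assumes "sgrp S" "g \<notin> S"
  obtains r where "r > 1" "nmul r g \<in> S" "\<And>j. 0 < j \<Longrightarrow> j < r \<Longrightarrow> nmul j g \<notin> S"
proof -
  define Q where "Q = (\<lambda>j. 0 < j \<and> nmul j g \<in> S)"
  have "sgrp (UNIV :: 'a set)" by (auto simp: sgrp_def)
  then have "nmul (card (UNIV :: 'a set)) g = 0"
    using nmul_card_sgrp[of UNIV g] by simp
  then have "Q (card (UNIV :: 'a set))"
    unfolding Q_def using assms by (auto simp: sgrp_zero finite_UNIV_card_ge_0)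
  then have "Q (LEAST j. Q j)" by (rule LeastI)
  moreover have "\<not> Q j" if "j < (LEAST j. Q j)" for j
    using that not_less_Least by blast
  moreover have "(LEAST j. Q j) \<noteq> 1"
    using calculation(1) assms by (auto simp: Q_def)
  ultimately show ?thesis
    using that[of "LEAST j. Q j"] by (auto simp: Q_def)
qed

lemma psubset_adjoin:
  assumes "sgrp S" "nmul r g \<in> S" "r > 0" "g \<notin> S"
  shows "S \<subset> adjoin S r g"
proof -
  have "s \<in> adjoin S r g" if "s \<in> S" for s
    by (rule adjoinI[OF assms(1-3), of s _ 0]) (use that in auto)
  then show ?thesis using adjoin_mem[OF assms(1-3)] assms(4) by blast
qed

text \<open>Lagrange's theorem by enlarging \<open>S\<close> one generator at a time: each step
  multiplies the order by \<open>r\<close>, and the chain ends at the whole group.\<close>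

lemma card_sgrp_dvd:
  fixes S :: "'a::{ab_group_add, finite} set"
  assumes "sgrp S"
  shows "card S dvd card (UNIV :: 'a set)"
  using assms
proof (induction "card (UNIV - S)" arbitrary: S rule: less_induct)
  case less
  show ?case
  proof (cases "S = UNIV")
    case False
    then obtain g where g: "g \<notin> S" by blast
    then obtain r where r: "r > 1" "nmul r g \<in> S" "\<And>j. 0 < j \<Longrightarrow> j < r \<Longrightarrow> nmul j g \<notin> S"
      using obtain_adjoin[OF less.prems] by blast
    have "S \<subset> adjoin S r g"
      using psubset_adjoin[OF less.prems r(2) _ g] r(1) by simp
    then have "card (UNIV - adjoin S r g) < card (UNIV - S)"
      by (intro psubset_card_mono) auto
    then have "card (adjoin S r g) dvd card (UNIV :: 'a set)"
      using less.hyps sgrp_adjoin[OF less.prems r(2)] r(1) by simp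
    then show ?thesis
      using card_adjoin[OF less.prems r(2,3)] by (metis dvd_mult_right)
  qed simp
qed

text \<open>Cauchy's theorem for the quotient by \<open>S\<close>. If the quotient had no element of
  order \<open>p\<close>, the same would hold after adjoining any \<open>g\<close>, with
  \<open>p\<close> still dividing the index; continuing up to the whole group gives index 1, a
  contradiction.\<close>

lemma cauchy_quotient:
  fixes S :: "'a::{ab_group_add, finite} set"
  assumes "sgrp S" "prime p" "p * card S dvd card (UNIV :: 'a set)"
  shows "\<exists>g. g \<notin> S \<and> nmul p g \<in> S"
proof (rule ccontr)
  assume "\<nexists>g. g \<notin> S \<and> nmul p g \<in> S"
  then have "\<forall>g. nmul p g \<in> S \<longrightarrow> g \<in> S" by blast
  with assms(1,3) show False
  proof (induction "card (UNIV - S)" arbitrary: S rule: less_induct)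
    case less
    have "S \<noteq> UNIV"
    proof
      assume "S = UNIV"
      then have "p * card (UNIV :: 'a set) dvd 1 * card (UNIV :: 'a set)"
        using less.prems by simp
      then have "p dvd 1"
        using finite_UNIV_card_ge_0[where 'a = 'a] by (simp del: mult_1)
      then show False using assms(2) by auto
    qed
    then obtain g where g: "g \<notin> S" by blast
    then obtain r where r: "r > 1" "nmul r g \<in> S" "\<And>j. 0 < j \<Longrightarrow> j < r \<Longrightarrow> nmul j g \<notin> S"
      using obtain_adjoin[OF less.prems(1)] by blast
    let ?S = "adjoin S r g"
    have sg: "sgrp ?S" using sgrp_adjoin[OF less.prems(1) r(2)] r(1) by simp
    have cardS: "card ?S = r * card S" by (rule card_adjoin[OF less.prems(1) r(2,3)])
    have "S \<subset> ?S"
      using psubset_adjoin[OF less.prems(1) r(2) _ g] r(1) by simp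
    then have lt: "card (UNIV - ?S) < card (UNIV - S)"
      by (intro psubset_card_mono) auto
    \<comment> \<open>Otherwise \<open>r = p * q\<close>, and \<open>nmul q g\<close> would have
      order \<open>p\<close> modulo \<open>S\<close>.\<close>
    have "\<not> p dvd r"
    proof
      assume "p dvd r"
      then obtain q where q: "r = p * q" by blast
      then have "nmul q g \<in> S" using less.prems(3) r(2) by (simp add: nmul_mult)
      moreover have "0 < q" "q < r" using q r(1) prime_gt_1_nat[OF assms(2)] by (auto intro!: Nat.gr0I)
      ultimately show False using r(3) by blast
    qed
    then have cop: "coprime p r" using assms(2) prime_imp_coprime by blast
    obtain c where c: "card (UNIV :: 'a set) = r * card S * c"
      using card_sgrp_dvd[OF sg] cardS by (auto elim: dvdE)
    have "card S > 0" using sgrp_zero[OF less.prems(1)] by (auto simp: card_gt_0_iff)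
    moreover have "card S * p dvd card S * (r * c)" using less.prems(2) c by (simp add: mult_ac)
    ultimately have "p dvd r * c" by (simp only: nat_mult_dvd_cancel1)
    then have "p dvd c" using cop by (simp add: coprime_dvd_mult_right_iff)
    then have dv: "p * card ?S dvd card (UNIV :: 'a set)"
      using c cardS by (auto simp: mult_ac)
    have "h \<in> ?S" if h: "nmul p h \<in> ?S" for h
    proof -
      obtain s j where sj: "s \<in> S" "nmul p h = s + nmul j g" using h by (metis adjoinE)
      \<comment> \<open>As \<open>p\<close> is invertible modulo \<open>r\<close>, some
        \<open>i\<close> satisfies \<open>p * i = j\<close> modulo \<open>r\<close>. Subtracting
        \<open>nmul i g\<close> from \<open>h\<close> brings its \<open>p\<close>-fold multiple into
        \<open>S\<close>, where the assumption on \<open>S\<close> applies.\<close>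
      obtain i' where "[p * i' = Suc 0] (mod r)"
        using cong_solve_coprime_nat[OF cop] by blast
      then have "[p * i' * j = Suc 0 * j] (mod r)" by (rule cong_scalar_right)
      then obtain i where i: "[j = p * i] (mod r)"
        by (metis cong_sym mult.assoc mult_Suc add_0_right mult_0)
      obtain a b where ab: "j + r * a = p * i + r * b"
        using i unfolding cong_iff_lin_nat by (metis mult.commute)
      have "nmul p (h - nmul i g) + nmul p (nmul i g) = nmul p h"
        by (simp flip: nmul_distrib)
      then have "nmul p (h - nmul i g) + nmul (p * i) g = s + nmul j g"
        using sj by (simp only: nmul_mult)
      then have "nmul p (h - nmul i g) = s + nmul j g - nmul (p * i) g"
        by (simp add: eq_diff_eq)
      also have "\<dots> = s + nmul b (nmul r g) - nmul a (nmul r g)"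
        using arg_cong[OF ab, of "\<lambda>n. nmul n g"]
        by (simp add: nmul_add nmul_mult[symmetric] mult.commute algebra_simps)
      also have "\<dots> \<in> S"
        using less.prems(1) sj r(2) by (simp add: sgrp_diff sgrp_add sgrp_nmul)
      finally have "h - nmul i g \<in> S" using less.prems(3) by blast
      then show ?thesis
        by (intro adjoinI[OF less.prems(1) r(2), of "h - nmul i g" _ i]) (use r in auto)
    qed
    then show False using less.hyps[OF lt sg dv] by blast
  qed
qed

text \<open>Each \<open>j\<close> with \<open>0 < j < p\<close> is invertible modulo
  \<open>p\<close>, so \<open>nmul j g\<close> in \<open>S\<close> would force \<open>g\<close> into
  \<open>S\<close>.\<close>

lemma card_adjoin_prime:
  fixes S :: "'a::ab_group_add set"
  assumes "sgrp S" "prime p" "g \<notin> S" "nmul p g \<in> S"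
  shows "card (adjoin S p g) = p * card S"
proof (rule card_adjoin[OF assms(1,4)])
  fix j assume j: "0 < j" "j < p"
  then have "coprime j p" using assms(2)
    by (metis coprime_commute dvd_imp_le not_less prime_imp_coprime)
  then obtain a b where ab: "j * a = p * b + 1"
    using j by (metis bezout_nat coprime_imp_gcd_eq_1 not_gr_zero less_numeral_extra(3))
  show "nmul j g \<notin> S"
  proof
    assume "nmul j g \<in> S"
    then have "nmul (a * j) g \<in> S" by (simp add: nmul_mult sgrp_nmul assms(1))
    moreover have "nmul (a * j) g = nmul b (nmul p g) + g"
      using ab by (simp add: mult.commute nmul_add nmul_mult[symmetric])
    moreover have "nmul b (nmul p g) \<in> S" by (simp add: sgrp_nmul assms)
    ultimately show False using assms(1,3) by (simp add: sgrp_add_cancel)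
  qed
qed

text \<open>The converse of Lagrange's theorem: split off a prime factor of \<open>d\<close> and
  adjoin an element of that order modulo a smaller subgroup.\<close>

lemma sgrp_of_card:
  assumes "d dvd card (UNIV :: 'a::{ab_group_add, finite} set)"
  shows "\<exists>S :: 'a set. sgrp S \<and> card S = d"
  using assms
proof (induction d rule: less_induct)
  case (less d)
  have "d \<noteq> 0" using less.prems by (intro notI) simp
  show ?case
  proof (cases "d = 1")
    case True
    then show ?thesis by (intro exI[of _ "{0}"]) (auto simp: sgrp_def)
  next
    case False
    then obtain p where p: "prime p" "p dvd d" using prime_factor_nat by blast
    then obtain e where e: "d = p * e" by blast
    have "e < d" using e prime_gt_1_nat[OF p(1)] \<open>d \<noteq> 0\<close> by simp
    moreover have "e dvd card (UNIV :: 'a set)" using e less.prems by (metis dvd_mult_right)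
    ultimately obtain S :: "'a set" where S: "sgrp S" "card S = e" using less.IH by blast
    obtain g where g: "g \<notin> S" "nmul p g \<in> S"
      using cauchy_quotient[OF S(1) p(1)] S(2) e less.prems by auto
    show ?thesis
      using sgrp_adjoin[OF S(1) g(2) prime_gt_0_nat[OF p(1)]] card_adjoin_prime[OF S(1) p(1) g] S e
      by blast
  qed
qed

section \<open>Subgroups of odd index and of odd order\<close>

lemma odd_index_halving:
  fixes H :: "'a::{ab_group_add, finite} set"
  assumes "sgrp H" "card (UNIV :: 'a set) = card H * (2 * l + 1)" "g + g \<in> H"
  shows "g \<in> H"
proof (rule ccontr)
  assume g: "g \<notin> H"
  \<comment> \<open>\<open>H\<close> would have index 2 in the subgroup it spans with
    \<open>g\<close>, so 2 would divide its odd index in the whole group.\<close>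
  have two: "nmul 2 g \<in> H" using assms(3) by simp
  have "2 * card H dvd card H * (2 * l + 1)"
    using card_sgrp_dvd[OF sgrp_adjoin[OF assms(1) two]] card_adjoin_prime[OF assms(1) two_is_prime_nat g two]
      assms(2) by simp
  then have "card H * 2 dvd card H * (2 * l + 1)" by (simp only: mult.commute)
  moreover have "card H > 0" using assms(1) by (auto simp: card_gt_0_iff sgrp_def)
  ultimately have "2 dvd 2 * l + 1" by (simp only: nat_mult_dvd_cancel1)
  then show False by presburger
qed

text \<open>Pairs of opposite cosets are chosen greedily. They are distinct since the quotient has
  odd order, so every choice adds exactly two new cosets, and after \<open>l\<close> choices
  counting shows that everything is covered.\<close>

lemma symmetric_representatives:
  fixes H :: "'a::{ab_group_add, finite} set"
  assumes H: "sgrp H" and card: "card (UNIV :: 'a set) = card H * (2 * l + 1)"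
  shows "\<exists>u :: nat \<Rightarrow> 'a. \<forall>x. x \<in> H \<or> (\<exists>i<l. x - u i \<in> H \<or> x + u i \<in> H)"
proof -
  define X where "X = (\<lambda>(u :: nat \<Rightarrow> 'a) (j :: nat). {x. x \<in> H \<or> (\<exists>i<j. x - u i \<in> H \<or> x + u i \<in> H)})"
  have Hpos: "card H > 0" using H by (auto simp: card_gt_0_iff sgrp_def)
  have "\<exists>u. card (X u j) = card H * (2 * j + 1)" if "j \<le> l" for j
    using that
  proof (induction j)
    case 0
    show ?case by (simp add: X_def)
  next
    case (Suc j)
    then obtain u where u: "card (X u j) = card H * (2 * j + 1)" by auto
    then have "card (X u j) < card (UNIV :: 'a set)" using Suc.prems card Hpos by simp
    then obtain g where g: "g \<notin> X u j" by (metis UNIV_eq_I less_irrefl)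
    define v where "v = u(j := g)"
    have Xv: "X v (Suc j) = X u j \<union> ((+) g ` H \<union> (+) (- g) ` H)"
    proof -
      have "x \<in> (+) g ` H \<longleftrightarrow> x - g \<in> H" "x \<in> (+) (- g) ` H \<longleftrightarrow> x + g \<in> H" for x
        by (force simp: image_iff algebra_simps)+
      moreover have "(\<exists>i<j. x - v i \<in> H \<or> x + v i \<in> H) \<longleftrightarrow> (\<exists>i<j. x - u i \<in> H \<or> x + u i \<in> H)" for x
        by (auto simp: v_def)
      moreover have "v j = g" by (simp add: v_def)
      ultimately show ?thesis
        by (intro set_eqI) (simp only: X_def Ex_less_Suc mem_Collect_eq Un_iff disj_ac)
    qed
    have "(+) g ` H \<inter> (+) (- g) ` H = {}"
    proof (rule ccontr)
      assume "(+) g ` H \<inter> (+) (- g) ` H \<noteq> {}"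
      then obtain a b where "a \<in> H" "b \<in> H" "g + a = - g + b" by auto
      then have "g + g = b - a" "b - a \<in> H" using H sgrp_diff by (auto simp: algebra_simps)
      then have "g \<in> H" using odd_index_halving[OF H card, of g] by argo
      then show False using g by (simp add: X_def)
    qed
    moreover have "X u j \<inter> ((+) g ` H \<union> (+) (- g) ` H) = {}"
    proof (rule ccontr)
      assume "X u j \<inter> ((+) g ` H \<union> (+) (- g) ` H) \<noteq> {}"
      then obtain a where a: "a \<in> H" "g + a \<in> X u j \<or> - g + a \<in> X u j" by auto
      \<comment> \<open>The part already covered is stable under translation by \<open>H\<close> and
        under negation, so meeting either new coset would put \<open>g\<close> itself into
        it.\<close>
      have 1: "g \<in> X u j" if *: "g + a \<in> X u j" "a \<in> H" for a
      proof -
        have "a + y \<in> H \<longleftrightarrow> y \<in> H" for y using sgrp_add_cancel[OF H *(2)] .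
        from this[of g] this[of "g - u _"] this[of "g + u _"] show ?thesis
          using *(1) by (auto simp: X_def algebra_simps)
      qed
      have 2: "- x \<in> X u j" if *: "x \<in> X u j" for x
      proof -
        have m: "- y \<in> H \<longleftrightarrow> y \<in> H" for y using sgrp_minus[OF H, of y] sgrp_minus[OF H, of "- y"] by auto
        from this[of x] this[of "x - u _"] this[of "x + u _"] show ?thesis
          using * by (auto simp: X_def algebra_simps)
      qed
      show False
        using a(2) 1[of a] 1[of "- a"] 2[of "- g + a"] a(1) g sgrp_minus[OF H a(1)]
        by (auto simp: algebra_simps)
    qed
    ultimately have "card (X v (Suc j)) = card H * (2 * Suc j + 1)"
      unfolding Xv by (subst card_Un_disjoint | simp add: u card_image)+
    then show ?case by blast
  qed
  then obtain u where "card (X u l) = card (UNIV :: 'a set)" using card by auto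
  then have "X u l = UNIV" by (intro card_subset_eq) auto
  then show ?thesis unfolding X_def by blast
qed

text \<open>Half of \<open>k\<close> is \<open>nmul (h + 1) k\<close>, since the order
  \<open>2 * h + 1\<close> annihilates \<open>k\<close>.\<close>

lemma odd_sgrp_halves:
  fixes K :: "'a::{ab_group_add, finite} set"
  assumes "sgrp K" "card K = 2 * h + 1" "k \<in> K"
  shows "\<exists>x\<in>K. x + x = k"
proof -
  have "nmul (h + 1) k + nmul (h + 1) k = nmul (card K) k + k"
    unfolding nmul_add[symmetric] assms(2) by (simp add: mult_2_right nmul_add algebra_simps)
  then show ?thesis
    using nmul_card_sgrp[OF assms(1,3)] sgrp_nmul[OF assms(1,3)] by (metis add_0)
qed

section \<open>Templates on a subgroup of order 16\<close>

text \<open>Of the rows \<open>0, 1, 2\<close> of two \<open>3 \<times> 8\<close> arrays, \<open>A\<close> fills row \<open>0\<close>, while \<open>B\<close> and \<open>C\<close>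
  fill the other two and are exchanged in the second half of each row.  \<open>D\<close> and \<open>- D\<close> fill a
  further pair of rows, exchanged in the same way.  Entry \<open>j\<close> of array \<open>r\<close> has index \<open>8 * r + j\<close>.\<close>

definition template :: "'a::ab_group_add set \<Rightarrow> (nat \<Rightarrow> 'a) \<Rightarrow> (nat \<Rightarrow> 'a) \<Rightarrow> (nat \<Rightarrow> 'a) \<Rightarrow> (nat \<Rightarrow> 'a) \<Rightarrow> bool" where
  "template P A B C D \<longleftrightarrow>
     (\<forall>f\<in>{A, B, C, D}. P \<subseteq> f ` {..<16}) \<and>
     (\<forall>j<16. A j + B j + C j = 0) \<and>
     (\<forall>r<2. (\<Sum>j<8. A (8 * r + j)) = 0 \<and>
            (\<Sum>j<8. (if j < 4 then B else C) (8 * r + j)) = 0 \<and>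
            (\<Sum>j<8. (if j < 4 then C else B) (8 * r + j)) = 0 \<and>
            (\<Sum>j<8. if j < 4 then D (8 * r + j) else - D (8 * r + j)) = 0)"

section \<open>Coordinates in which tables can be checked by evaluation\<close>

type_synonym coords = "nat \<times> nat \<times> nat \<times> nat"

fun lin :: "'a::ab_group_add \<Rightarrow> 'a \<Rightarrow> 'a \<Rightarrow> 'a \<Rightarrow> coords \<Rightarrow> 'a" where
  "lin g\<^sub>1 g\<^sub>2 x y (a, b, c, d) = nmul a g\<^sub>1 + nmul b g\<^sub>2 + nmul c x + nmul d y"

lemma lin_zero: "lin g\<^sub>1 g\<^sub>2 x y 0 = 0"
  by (simp add: zero_prod_def)

lemma lin_add: "lin g\<^sub>1 g\<^sub>2 x y (p + q) = lin g\<^sub>1 g\<^sub>2 x y p + lin g\<^sub>1 g\<^sub>2 x y q"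
  by (cases p; cases q) (simp add: nmul_add algebra_simps)

lemma lin_sum: "lin g\<^sub>1 g\<^sub>2 x y (sum f S) = (\<Sum>s\<in>S. lin g\<^sub>1 g\<^sub>2 x y (f s))"
  by (induction S rule: infinite_finite_induct) (auto simp: lin_zero lin_add)

text \<open>A decidable condition under which \<open>lin\<close> vanishes, so that identities in an
  arbitrary group reduce to divisibility of natural numbers.\<close>

fun null :: "nat \<Rightarrow> coords \<Rightarrow> bool" where
  "null N (a, b, c, d) \<longleftrightarrow> N dvd a \<and> N dvd b \<and> 2 dvd c \<and> 2 dvd d"

lemma lin_null:
  assumes "nmul N g\<^sub>1 = 0" "nmul N g\<^sub>2 = 0" "x + x = 0" "y + y = 0" "null N q"
  shows "lin g\<^sub>1 g\<^sub>2 x y q = 0"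
proof -
  have *: "nmul k z = 0" if "m dvd k" "nmul m z = 0" for k m and z :: 'a
    using that by (auto elim!: dvdE simp: mult.commute[of m] nmul_mult)
  have two: "nmul 2 x = 0" "nmul 2 y = 0" using assms by simp_all
  obtain a b c d where q: "q = (a, b, c, d)" by (cases q)
  have "nmul a g\<^sub>1 = 0" "nmul b g\<^sub>2 = 0" "nmul c x = 0" "nmul d y = 0"
    using assms(5) *[OF _ assms(1)] *[OF _ assms(2)] *[OF _ two(1)] *[OF _ two(2)] unfolding q by auto
  then show ?thesis by (simp add: q)
qed

text \<open>In \<open>D\<close>, the second half of every block of eight is subtracted.  The coset
  \<open>{e, e + x, e + y, e + x + y}\<close> of a Klein four-group contributes
  \<open>e + (e + x + y) - (e + x) - (e + y) = 0\<close>.\<close>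

definition klein_blocks :: "(nat \<Rightarrow> 'a::ab_group_add) \<Rightarrow> 'a \<Rightarrow> 'a \<Rightarrow> nat \<Rightarrow> 'a" where
  "klein_blocks e x y j =
    (let f = e (2 * (j div 8) + j div 2 mod 2) in
     if j mod 8 < 4 then (if even j then f else f + x + y) else (if even j then f + x else f + y))"

lemma sum_8: "(\<Sum>j<8. f j) = f 0 + f 1 + f 2 + f 3 + f 4 + f 5 + f 6 + f (7::nat)"
  by (simp add: eval_nat_numeral add.assoc)

lemma klein_blocks_sum:
  assumes "r < 2"
  shows "(\<Sum>j<8. if j < 4 then klein_blocks e x y (8 * r + j) else - klein_blocks e x y (8 * r + j)) = 0"
proof -
  have "r = 0 \<or> r = 1" using assms by auto
  then show ?thesis by (auto simp: sum_8 klein_blocks_def Let_def)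
qed

lemma klein_blocks_surj:
  assumes "i < 4" "v \<in> {0, x, y, x + y}"
  shows "e i + v \<in> klein_blocks e x y ` {..<16}"
proof -
  have *: "e i + v \<in> klein_blocks e x y ` {..<16}" if "klein_blocks e x y j = e i + v" "j < 16" for j
    using that by (metis imageI lessThan_iff)
  have i: "i \<in> {0, 1, 2, 3}" using assms(1) by auto
  consider "v = 0" | "v = x" | "v = y" | "v = x + y" using assms(2) by auto
  then show ?thesis
  proof cases
    \<comment> \<open>Position \<open>8 * (i div 2) + 2 * (i mod 2)\<close> holds
      \<open>e i\<close>; the offsets 4, 5 and 1 give \<open>x\<close>, \<open>y\<close> and
      \<open>x + y\<close>, the last being written out as \<open>[1, 3, 9, 11]\<close>.\<close>
    case 1 show ?thesis by (rule *[of "8 * (i div 2) + 2 * (i mod 2)"]) (use i 1 in \<open>auto simp: klein_blocks_def\<close>)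
  next
    case 2 show ?thesis by (rule *[of "8 * (i div 2) + 2 * (i mod 2) + 4"]) (use i 2 in \<open>auto simp: klein_blocks_def\<close>)
  next
    case 3 show ?thesis by (rule *[of "8 * (i div 2) + 2 * (i mod 2) + 5"]) (use i 3 in \<open>auto simp: klein_blocks_def\<close>)
  next
    case 4 show ?thesis by (rule *[of "[1, 3, 9, 11] ! i"]) (use i 4 in \<open>auto simp: klein_blocks_def add.assoc\<close>)
  qed
qed

definition balanced_tables :: "nat \<Rightarrow> coords list \<Rightarrow> coords list \<Rightarrow> coords list \<Rightarrow> bool" where
  "balanced_tables N A B C \<longleftrightarrow>
     length A = 16 \<and> length B = 16 \<and> length C = 16 \<and>
     (\<forall>j\<in>{..<16}. null N (A ! j + B ! j + C ! j)) \<and>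
     (\<forall>r\<in>{..<2}. null N (\<Sum>j<8. A ! (8 * r + j)) \<and>
            null N (\<Sum>j<8. (if j < 4 then B else C) ! (8 * r + j)) \<and>
            null N (\<Sum>j<8. (if j < 4 then C else B) ! (8 * r + j)))"

text \<open>The tables supply the first three bijections; the fourth is
  \<open>klein_blocks e x y\<close>, with \<open>e\<close> listing representatives of the cosets of
  the Klein group.\<close>

lemma template_of_tables:
  fixes e :: "nat \<Rightarrow> 'a::ab_group_add"
  assumes "balanced_tables N A B C"
    and N: "nmul N g\<^sub>1 = 0" "nmul N g\<^sub>2 = 0" and xy: "x + x = 0" "y + y = 0"
    and P: "\<And>p. p \<in> P \<Longrightarrow> \<exists>i<4. \<exists>v\<in>{0, x, y, x + y}. p = e i + v"
    and surj: "\<And>T. T \<in> {A, B, C} \<Longrightarrow> P \<subseteq> lin g\<^sub>1 g\<^sub>2 x y ` set T"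
  shows "\<exists>A B C D. template P A B C D"
proof -
  let ?t = "\<lambda>T j. lin g\<^sub>1 g\<^sub>2 x y (T ! j)"
  note null = lin_null[OF N xy]
  have 1: "P \<subseteq> ?t T ` {..<16}" if "T \<in> {A, B, C}" for T
  proof -
    have "length T = 16" using that assms(1) by (auto simp: balanced_tables_def)
    then have "set T = (!) T ` {..<16}" using nth_image[of 16 T] by (simp add: lessThan_atLeast0)
    then show ?thesis using surj[OF that] by (simp add: image_image)
  qed
  have 2: "P \<subseteq> klein_blocks e x y ` {..<16}"
  proof
    fix p assume "p \<in> P"
    then obtain i v where "i < 4" "v \<in> {0, x, y, x + y}" "p = e i + v" using P by blast
    then show "p \<in> klein_blocks e x y ` {..<16}" using klein_blocks_surj by blast
  qed
  have 3: "?t A j + ?t B j + ?t C j = 0" if "j < 16" for j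
    using that assms(1) null by (simp add: balanced_tables_def flip: lin_add)
  have 4: "(\<Sum>j<8. ?t A (8 * r + j)) = 0"
     "(\<Sum>j<8. (if j < 4 then ?t B else ?t C) (8 * r + j)) = 0"
     "(\<Sum>j<8. (if j < 4 then ?t C else ?t B) (8 * r + j)) = 0" if "r < 2" for r
  proof -
    have if_app: "(if b then ?t S else ?t T) j = lin g\<^sub>1 g\<^sub>2 x y ((if b then S else T) ! j)" for b S T j
      by simp
    show "(\<Sum>j<8. ?t A (8 * r + j)) = 0"
     "(\<Sum>j<8. (if j < 4 then ?t B else ?t C) (8 * r + j)) = 0"
     "(\<Sum>j<8. (if j < 4 then ?t C else ?t B) (8 * r + j)) = 0"
      unfolding if_app lin_sum[symmetric]
      using that assms(1) by (auto intro!: null simp: balanced_tables_def)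
  qed
  have "template P (?t A) (?t B) (?t C) (klein_blocks e x y)"
    unfolding template_def
    by (intro conjI allI impI 3 4 klein_blocks_sum) (use 1 2 in \<open>simp_all\<close>)
  then show ?thesis by blast
qed

text \<open>Each group of four columns consists of the columns \<open>(r + v, \<omega>r + \<omega>v, \<omega>\<^sup>2r + \<omega>\<^sup>2v)\<close> for \<open>v\<close> in the
  Klein group, where \<open>\<omega>\<close> permutes cyclically \<open>x, y, x + y\<close> and the coset representatives
  \<open>g\<^sub>1, g\<^sub>2, 3g\<^sub>1 + 3g\<^sub>2\<close>.\<close>

definition split_A :: "coords list" where
  "split_A = [
    (0,0,0,0), (0,0,1,0), (0,0,0,1), (0,0,1,1),
                       (1,0,0,0), (1,0,1,0), (1,0,0,1), (1,0,1,1),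
                       (0,1,0,0), (0,1,1,0), (0,1,0,1), (0,1,1,1),
                       (3,3,0,0), (3,3,1,0), (3,3,0,1), (3,3,1,1)]"
definition split_B :: "coords list" where
  "split_B = [
    (0,0,0,0), (0,0,0,1), (0,0,1,1), (0,0,1,0),
                       (0,1,0,0), (0,1,0,1), (0,1,1,1), (0,1,1,0),
                       (3,3,0,0), (3,3,0,1), (3,3,1,1), (3,3,1,0),
                       (1,0,0,0), (1,0,0,1), (1,0,1,1), (1,0,1,0)]"
definition split_C :: "coords list" where
  "split_C = [
    (0,0,0,0), (0,0,1,1), (0,0,1,0), (0,0,0,1),
                       (3,3,0,0), (3,3,1,1), (3,3,1,0), (3,3,0,1),
                       (1,0,0,0), (1,0,1,1), (1,0,1,0), (1,0,0,1),
                       (0,1,0,0), (0,1,1,1), (0,1,1,0), (0,1,0,1)]"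

text \<open>Columns vanish because the three images of \<open>v\<close> sum to zero and
  \<open>g\<^sub>1 + g\<^sub>2 + (3g\<^sub>1 + 3g\<^sub>2)\<close> is zero modulo 4. Each group of
  four columns runs through a coset of the Klein group in every row, so its sum is null by itself
  and exchanging \<open>B\<close> and \<open>C\<close> is harmless.\<close>

lemma balanced_split: "balanced_tables 4 split_A split_B split_C"
  by code_simp

text \<open>These tables were found by computer search; coefficients of \<open>g\<close> are modulo 8.  The coset \<open>2g + V\<close> is written as
  \<open>{2g, 2g + x, -2g + y, -2g + x + y}\<close>, which is correct both for \<open>4g = 0\<close> and for \<open>4g = x\<close>.\<close>

definition cyclic_A :: "coords list" where
  "cyclic_A = [
    (7,0,1,0), (0,0,1,0), (0,0,1,1), (1,0,1,1), (6,0,0,1), (6,0,1,1), (2,0,0,0), (2,0,1,0),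
   (1,0,0,1), (1,0,1,0), (7,0,1,1), (1,0,0,0), (7,0,0,1), (0,0,0,0), (7,0,0,0), (0,0,0,1)]"
definition cyclic_B :: "coords list" where
  "cyclic_B = [
    (2,0,0,0), (0,0,0,1), (6,0,0,1), (1,0,0,0), (1,0,0,1), (2,0,1,0), (7,0,0,1), (7,0,1,0),
   (6,0,1,1), (1,0,1,1), (7,0,1,1), (0,0,1,1), (0,0,1,0), (0,0,0,0), (1,0,1,0), (7,0,0,0)]"
definition cyclic_C :: "coords list" where
  "cyclic_C = [
    (7,0,1,0), (0,0,1,1), (2,0,1,0), (6,0,1,1), (1,0,0,0), (0,0,0,1), (7,0,0,1), (7,0,0,0),
   (1,0,1,0), (6,0,0,1), (2,0,0,0), (7,0,1,1), (1,0,1,1), (0,0,0,0), (0,0,1,0), (1,0,0,1)]"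

lemma balanced_cyclic: "balanced_tables 8 cyclic_A cyclic_B cyclic_C"
  by code_simp

lemma klein_simps:
  fixes x y :: "'a::ab_group_add"
  assumes "x + x = 0" "y + y = 0"
  shows "x + x = 0" "y + y = 0" "x + (x + z) = z" "y + (y + z) = z" "- x = x" "- y = y"
proof -
  show "x + (x + z) = z" "y + (y + z) = z"
    using assms by (simp_all flip: add.assoc)
  show "- x = x" "- y = y"
    using assms by (simp_all add: minus_unique)
qed (fact assms)+

lemma sgrp_klein:
  fixes x y :: "'a::ab_group_add"
  assumes "x + x = 0" "y + y = 0"
  shows "sgrp {0, x, y, x + y}"
  by (auto simp: sgrp_def klein_simps[OF assms] add_ac)

lemma split_template:
  fixes x y g\<^sub>1 g\<^sub>2 :: "'a::ab_group_add"
  defines "V \<equiv> {0, x, y, x + y}"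
  assumes xy: "x + x = 0" "y + y = 0" and g: "g\<^sub>1 + g\<^sub>1 \<in> V" "g\<^sub>2 + g\<^sub>2 \<in> V"
  shows "\<exists>A B C D. template (adjoin (adjoin V 2 g\<^sub>1) 2 g\<^sub>2) A B C D"
proof -
  have V: "sgrp V"
    unfolding V_def by (rule sgrp_klein[OF xy])
  have VV: "v + v = 0" if "v \<in> V" for v
    using that by (auto simp: V_def klein_simps[OF xy] add_ac)
  \<comment> \<open>The last representative is \<open>3g\<^sub>1 + 3g\<^sub>2\<close> rather than
    \<open>g\<^sub>1 + g\<^sub>2\<close>, to make the sum of all four zero.\<close>
  define q :: "nat \<Rightarrow> nat \<times> nat" where "q = (!) [(0,0), (1,0), (0,1), (3,3)]"
  define e where "e = (\<lambda>i. nmul (fst (q i)) g\<^sub>1 + nmul (snd (q i)) g\<^sub>2)"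
  have four: "nmul 4 g\<^sub>1 = 0" "nmul 4 g\<^sub>2 = 0"
    using VV[OF g(1)] VV[OF g(2)] by (simp_all add: add.assoc)
  have cover: "\<exists>i<4. \<exists>v\<in>V. p = e i + v" if p: "p \<in> adjoin (adjoin V 2 g\<^sub>1) 2 g\<^sub>2" for p
  proof -
    obtain s b where s: "s \<in> adjoin V 2 g\<^sub>1" "b < 2" "p = s + nmul b g\<^sub>2"
      by (rule adjoinE[OF p])
    obtain w a where "w \<in> V" "a < 2" "s = w + nmul a g\<^sub>1"
      by (rule adjoinE[OF s(1)])
    with s have w: "w \<in> V" "a < 2" "b < 2" "p = w + nmul a g\<^sub>1 + nmul b g\<^sub>2"
      by simp_all
    have "a = 0 \<or> a = 1" "b = 0 \<or> b = 1" using w(2,3) by auto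
    then consider "a = 0" "b = 0" | "a = 1" "b = 0" | "a = 0" "b = 1" | "a = 1" "b = 1" by blast
    then show ?thesis
    proof cases
      case 4
      have "e 3 + (w + (g\<^sub>1 + g\<^sub>1) + (g\<^sub>2 + g\<^sub>2)) = w + g\<^sub>1 + g\<^sub>2 + (nmul 4 g\<^sub>1 + nmul 4 g\<^sub>2)"
        by (simp add: e_def q_def add_ac)
      then have "p = e 3 + (w + (g\<^sub>1 + g\<^sub>1) + (g\<^sub>2 + g\<^sub>2))"
        unfolding four using w(4) 4 by simp
      moreover have "w + (g\<^sub>1 + g\<^sub>1) + (g\<^sub>2 + g\<^sub>2) \<in> V" using w g V by (simp add: sgrp_add)
      ultimately show ?thesis by (intro exI[of _ 3]) auto
    next
      case 1 then show ?thesis using w(1,4) by (intro exI[of _ 0]) (auto simp: e_def q_def)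
    next
      case 2 then show ?thesis using w(1,4) by (intro exI[of _ 1]) (auto simp: e_def q_def add_ac)
    next
      case 3 then show ?thesis using w(1,4) by (intro exI[of _ 2]) (auto simp: e_def q_def add_ac)
    qed
  qed
  have set: "e i + v \<in> lin g\<^sub>1 g\<^sub>2 x y ` set T"
    if T: "T \<in> {split_A, split_B, split_C}" and iv: "i < 4" "v \<in> V" for T i v
  proof -
    have "\<exists>c\<in>{0, 1}. \<exists>d\<in>{0, 1}. v = nmul c x + nmul d y"
      using iv(2) by (auto simp: V_def)
    then obtain c d where cd: "c \<in> {0, 1}" "d \<in> {0, 1}" "v = nmul c x + nmul d y"
      by blast
    have "i \<in> {0, 1, 2, 3}" using iv(1) by auto
    then have "(fst (q i), snd (q i), c, d) \<in> set T"
      using T cd(1,2)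
      by (elim insertE emptyE; simp add: q_def split_A_def split_B_def split_C_def)
    moreover have "e i + v = lin g\<^sub>1 g\<^sub>2 x y (fst (q i), snd (q i), c, d)"
      by (simp add: e_def cd(3) add.assoc)
    ultimately show ?thesis by (rule rev_image_eqI)
  qed
  show ?thesis
  proof (rule template_of_tables[OF balanced_split four xy])
    fix p assume "p \<in> adjoin (adjoin V 2 g\<^sub>1) 2 g\<^sub>2"
    then show "\<exists>i<4. \<exists>v\<in>{0, x, y, x + y}. p = e i + v" using cover unfolding V_def by blast
  next
    fix T assume "T \<in> {split_A, split_B, split_C}"
    then show "adjoin (adjoin V 2 g\<^sub>1) 2 g\<^sub>2 \<subseteq> lin g\<^sub>1 g\<^sub>2 x y ` set T"
      using cover set[of T] by (metis subsetI)
  qed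
qed

lemma cyclic_template_aux:
  fixes x y g :: "'a::ab_group_add"
  defines "V \<equiv> {0, x, y, x + y}"
  assumes xy: "x + x = 0" "y + y = 0" and g: "nmul 4 g = 0 \<or> nmul 4 g = x"
    and P: "\<And>p. p \<in> P \<Longrightarrow> \<exists>i<4. \<exists>v\<in>V. p = nmul i g + v"
  shows "\<exists>A B C D. template P A B C D"
proof -
  have eight: "nmul 8 g = 0"
  proof -
    have "nmul 8 g = nmul 4 g + nmul 4 g" by (simp flip: nmul_add)
    then show ?thesis using g xy by (elim disjE) (simp_all only: add_0)
  qed
  have set: "nmul i g + v \<in> lin g 0 x y ` set T"
    if "T \<in> {cyclic_A, cyclic_B, cyclic_C}" and i: "i < 4" and v: "v \<in> V" for T i v
  proof -
    have T: "(i, 0, c, d) \<in> set T" if "i \<in> {0, 1, 7}" "c \<in> {0, 1}" "d \<in> {0, 1}" for i c d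
      using that \<open>T \<in> _\<close> by (elim insertE emptyE; simp add: cyclic_A_def cyclic_B_def cyclic_C_def)
    have T': "(2,0,0,0) \<in> set T" "(2,0,1,0) \<in> set T" "(6,0,0,1) \<in> set T" "(6,0,1,1) \<in> set T"
      using that(1) by (elim insertE emptyE; simp add: cyclic_A_def cyclic_B_def cyclic_C_def)+
    have *: "z \<in> lin g 0 x y ` set T" if "q \<in> set T" "z = lin g 0 x y q" for z q
      using that by blast
    have x: "x + (x + z) = z" for z using xy by (simp flip: add.assoc)
    have coords_V: "\<exists>c\<in>{0, 1}. \<exists>d\<in>{0, 1}. v = nmul c x + nmul d y" if "v \<in> V" for v
      using that by (auto simp: V_def)
      have "i = 0 \<or> i = 1 \<or> i = 2 \<or> i = 3" using i by auto
      moreover have "nmul 3 g + v \<in> lin g 0 x y ` set T"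
      proof -
        have "nmul 4 g + v \<in> V"
          using g v sgrp_add[OF sgrp_klein[OF xy], of "nmul 4 g" v] by (auto simp: V_def simp del: nmul_numeral)
        then obtain c d where cd: "c \<in> {0, 1}" "d \<in> {0, 1}" "nmul 4 g + v = nmul c x + nmul d y"
          using coords_V by blast
        \<comment> \<open>The tables list the coset of \<open>3g\<close> as that of
          \<open>7g\<close>; the two agree because \<open>4g\<close> lies in \<open>V\<close> and
          \<open>8g = 0\<close>.\<close>
        have "nmul 7 g + (nmul 4 g + v) \<in> lin g 0 x y ` set T"
          by (rule *[OF T[of 7 c d]]) (use cd in \<open>auto simp: add.assoc simp del: nmul_numeral\<close>)
        moreover have "nmul 7 g + (nmul 4 g + v) = nmul 3 g + v + nmul 8 g"
          by (simp add: add_ac)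
        ultimately show ?thesis using eight by (simp only: add_0_right)
      qed
      moreover have "nmul 2 g + v \<in> lin g 0 x y ` set T"
      proof (cases "v \<in> {0, x}")
        case True
        then consider "v = 0" | "v = x" by blast
        then show ?thesis
          by cases (rule *[OF T'(1)] *[OF T'(2)]; simp del: nmul_numeral; fail)+
      next
        case False
        then have v: "v = y \<or> v = x + y" using v by (auto simp: V_def)
        \<comment> \<open>Adding \<open>4g\<close>, which is \<open>0\<close> or \<open>x\<close>,
          keeps \<open>v\<close> within \<open>{y, x + y}\<close>; these two elements of the coset
          are tabulated with coefficient 6.\<close>
        consider "nmul 4 g + v = y" | "nmul 4 g + v = x + y"
          using v g x by (elim disjE) (simp_all add: add_ac del: nmul_numeral)
        then have "nmul 6 g + (nmul 4 g + v) \<in> lin g 0 x y ` set T"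
          by cases (rule *[OF T'(3)] *[OF T'(4)]; simp add: add.assoc del: nmul_numeral; fail)+
        moreover have "nmul 6 g + (nmul 4 g + v) = nmul 2 g + v + nmul 8 g"
          by (simp add: add_ac)
        ultimately show ?thesis using eight by (simp only: add_0_right)
      qed
      moreover have "nmul i g + v \<in> lin g 0 x y ` set T" if "i = 0 \<or> i = 1"
      proof -
        obtain c d where cd: "c \<in> {0, 1}" "d \<in> {0, 1}" "v = nmul c x + nmul d y"
          using v coords_V by blast
        show ?thesis
          by (rule *[OF T[of i c d]]) (use that cd in \<open>auto simp: add.assoc\<close>)
      qed
      ultimately show ?thesis by metis
  qed
  show ?thesis
  proof (rule template_of_tables[OF balanced_cyclic eight _ xy])
    fix T assume "T \<in> {cyclic_A, cyclic_B, cyclic_C}"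
    then show "P \<subseteq> lin g 0 x y ` set T"
      using P set[of T] by (metis subsetI)
  next
    fix p assume "p \<in> P"
    then show "\<exists>i<4. \<exists>v\<in>{0, x, y, x + y}. p = nmul i g + v" using P unfolding V_def by blast
  qed simp
qed

text \<open>The roles of \<open>x\<close>, \<open>y\<close>, \<open>x + y\<close> are interchangeable, so \<open>4g\<close> may be assumed to be \<open>0\<close> or \<open>x\<close>.\<close>

lemma cyclic_template:
  fixes x y g :: "'a::ab_group_add"
  defines "V \<equiv> {0, x, y, x + y}"
  assumes xy: "x + x = 0" "y + y = 0" and g: "nmul 4 g \<in> V"
    and P: "\<And>p. p \<in> P \<Longrightarrow> \<exists>i<4. \<exists>v\<in>V. p = nmul i g + v"
  shows "\<exists>A B C D. template P A B C D"
proof -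
  have *: "x + (x + y) = y" "y + (x + y) = x" "(x + y) + (x + y) = 0"
    by (simp_all add: klein_simps[OF xy] add_ac)
  consider "nmul 4 g = 0 \<or> nmul 4 g = x" | "nmul 4 g = y" | "nmul 4 g = x + y"
    using g by (auto simp: V_def)
  then show ?thesis
  proof cases
    case 1 then show ?thesis using cyclic_template_aux[OF xy, of g P] P by (simp add: V_def)
  next
    case 2
    moreover have "V = {0, y, x, y + x}" by (auto simp: V_def add.commute)
    ultimately show ?thesis using cyclic_template_aux[OF xy(2,1), of g P] P by simp
  next
    case 3
    moreover have "V = {0, x + y, x, x + y + x}" using *(1) by (auto simp: V_def add.commute add.left_commute)
    ultimately show ?thesis using cyclic_template_aux[OF *(3) xy(1), of g P] P by simp
  qed
qed

lemma template_exists: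
  fixes G :: "'a::{ab_group_add, finite} itself"
  assumes card: "card (UNIV :: 'a set) = 16 * m" and inv: "card (involutions :: 'a set) > 1"
  shows "\<exists>(P :: 'a set) A B C D. sgrp P \<and> card P = 16 \<and> template P A B C D"
proof -
  have "\<not> card (involutions :: 'a set) \<le> Suc 0" using inv by simp
  then obtain x y :: 'a where "x \<in> involutions" "y \<in> involutions" "x \<noteq> y"
    by (subst (asm) card_le_Suc0_iff_eq) auto
  then have xy: "x + x = 0" "y + y = 0" and ne: "x \<noteq> 0" "y \<noteq> 0" "x \<noteq> y"
    by (auto simp: involutions_def)
  have "x + y \<noteq> 0" using ne(3) klein_simps(6)[OF xy] by (metis eq_neg_iff_add_eq_0)
  define V where "V = {0, x, y, x + y}"
  have V: "sgrp V" "card V = 4"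
    using sgrp_klein[OF xy] ne \<open>x + y \<noteq> 0\<close> by (simp_all add: V_def)
  have VV: "v + v = 0" if "v \<in> V" for v
    using that by (auto simp: V_def klein_simps[OF xy] add_ac)
  obtain g\<^sub>1 where g1: "g\<^sub>1 \<notin> V" "nmul 2 g\<^sub>1 \<in> V"
    using cauchy_quotient[OF V(1) two_is_prime_nat] V(2) card by auto
  define W where "W = adjoin V 2 g\<^sub>1"
  have W: "sgrp W" "card W = 8"
    unfolding W_def using sgrp_adjoin[OF V(1) g1(2)] card_adjoin_prime[OF V(1) two_is_prime_nat g1] V(2)
    by simp_all
  obtain g\<^sub>2 where g2: "g\<^sub>2 \<notin> W" "nmul 2 g\<^sub>2 \<in> W"
    using cauchy_quotient[OF W(1) two_is_prime_nat] W(2) card by auto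
  define P where "P = adjoin W 2 g\<^sub>2"
  have P: "sgrp P" "card P = 16"
    unfolding P_def using sgrp_adjoin[OF W(1) g2(2)] card_adjoin_prime[OF W(1) two_is_prime_nat g2] W(2)
    by simp_all
  have "\<exists>A B C D. template P A B C D"
  proof (cases "g\<^sub>2 + g\<^sub>2 \<in> V")
    case True
    then show ?thesis
      using split_template[OF xy, of g\<^sub>1 g\<^sub>2] g1(2) unfolding V_def P_def W_def by simp
  next
    case False
    \<comment> \<open>Since \<open>2g\<^sub>2\<close> lies in \<open>W\<close> but not in
      \<open>V\<close>, it is congruent to \<open>g\<^sub>1\<close>; hence \<open>g\<^sub>2\<close>
      alone generates \<open>P\<close> modulo \<open>V\<close>.\<close>
    obtain v a where v: "v \<in> V" "a < 2" "nmul 2 g\<^sub>2 = v + nmul a g\<^sub>1"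
      using adjoinE[OF g2(2)[unfolded W_def]] by blast
    have "a \<noteq> 0" using v False by (intro notI) simp
    then have "a = 1" using v(2) by simp
    then have g12: "g\<^sub>2 + g\<^sub>2 = v + g\<^sub>1" using v(3) by simp
    have "nmul 4 g\<^sub>2 = (g\<^sub>2 + g\<^sub>2) + (g\<^sub>2 + g\<^sub>2)" by (simp add: add_ac)
    also have "\<dots> = (v + v) + (g\<^sub>1 + g\<^sub>1)" unfolding g12 by (simp add: add_ac)
    also have "\<dots> \<in> V" using g1(2) VV[OF v(1)] by simp
    finally have four: "nmul 4 g\<^sub>2 \<in> V" .
    show ?thesis
    proof (rule cyclic_template[OF xy four[unfolded V_def]])
      fix p assume "p \<in> P"
      then obtain w c b where w: "w \<in> V" "c < 2" "b < 2" "p = w + nmul c g\<^sub>1 + nmul b g\<^sub>2"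
        unfolding P_def W_def by (elim adjoinE) blast
      have g1: "g\<^sub>1 = g\<^sub>2 + g\<^sub>2 - v" using g12 by (simp add: algebra_simps)
      have "c = 0 \<or> c = 1" using w(2) by auto
      then have "\<exists>i<4. \<exists>v\<in>V. p = nmul i g\<^sub>2 + v"
      proof
        assume "c = 0"
        then show ?thesis using w by (intro exI[of _ b]) (auto simp: add_ac)
      next
        assume "c = 1"
        then have "p = nmul (2 + b) g\<^sub>2 + (w - v)"
          using w(4) g1 by (simp add: algebra_simps)
        moreover have "w - v \<in> V" using sgrp_diff[OF V(1) w(1) v(1)] .
        ultimately show ?thesis using w(3) by (intro exI[of _ "2 + b"]) auto
      qed
      then show "\<exists>i<4. \<exists>v\<in>{0, x, y, x + y}. p = nmul i g\<^sub>2 + v" unfolding V_def .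
    qed
  qed
  then show ?thesis using P by blast
qed

section \<open>Construction of the magic rectangle set\<close>

lemma sum_odd_split:
  fixes f :: "nat \<Rightarrow> 'a::comm_monoid_add"
  shows "(\<Sum>i<2 * l + 1. f i) = f 0 + (\<Sum>t<l. f (2 * t + 1) + f (2 * t + 2))"
  by (induction l) (auto simp: add_ac)

definition sgn_half :: "nat \<Rightarrow> 'a::ab_group_add \<Rightarrow> 'a" where
  "sgn_half j x = (if j < 4 then x else - x)"

lemma sum_sgn_half: "(\<Sum>j<8. sgn_half j x) = 0"
  by (simp add: sum_8 sgn_half_def)

context
  fixes A B C D :: "nat \<Rightarrow> 'a::ab_group_add" and u \<kappa> :: "nat \<Rightarrow> 'a"
begin

text \<open>Row \<open>0\<close> lies in \<open>P + K\<close>; rows \<open>2t + 1\<close> and \<open>2t + 2\<close> lie in the cosets of \<open>\<plusminus> u t\<close>,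
  the signs being exchanged between the two halves of a row.  In \<open>K\<close>, every column of the rows
  \<open>0, 1, 2\<close> is \<open>\<plusminus> (\<kappa>, \<kappa>, -2\<kappa>)\<close>.\<close>

definition rect :: "nat \<Rightarrow> nat \<Rightarrow> nat \<Rightarrow> 'a" where
  "rect k i j =
    (let J = 8 * (k mod 2) + j; c = \<kappa> (k div 2); t = (i - 1) div 2 in
     if i = 0 then A J + sgn_half j c
     else if t = 0 then
       (if odd i = (j < 4) then u 0 + B J else - u 0 + C J) +
       sgn_half j (if odd i then c else - (c + c))
     else if odd i = (j < 4) then u t + (D J + c)
     else - (u t + (D J + c)))"

lemma rect_column_sum:
  assumes "template P A B C D" "j < 8" "l \<ge> 1"
  shows "(\<Sum>i<2 * l + 1. rect k i j) = 0"
proof -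
  let ?J = "8 * (k mod 2) + j"
  have J: "?J < 16" using assms(2) by (cases "even k") auto
  obtain l' where l': "l = Suc l'" using assms(3) by (cases l) auto
  have "(\<Sum>t<l'. rect k (2 * Suc t + 1) j + rect k (2 * Suc t + 2) j) = 0"
    by (intro sum.neutral) (auto simp: rect_def Let_def)
  \<comment> \<open>The two terms in \<open>u 0\<close> are opposite, and the components in
    \<open>K\<close> are \<open>c, c, -2c\<close> up to a common sign.\<close>
  moreover have "rect k 0 j + (rect k 1 j + rect k 2 j) = A ?J + B ?J + C ?J"
    by (simp add: rect_def Let_def sgn_half_def)
  moreover have "A ?J + B ?J + C ?J = 0"
    using assms(1) J by (simp add: template_def)
  ultimately show ?thesis
    unfolding sum_odd_split l' sum.lessThan_Suc_shift by (simp add: numeral_2_eq_2 flip: add.assoc)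
qed

text \<open>Terms constant along a row change sign at its middle and cancel; what remains is a row
  sum of the template.\<close>

lemma rect_row_sum:
  assumes "template P A B C D"
  shows "(\<Sum>j<8. rect k i j) = 0"
proof -
  let ?r = "k mod 2" and ?c = "\<kappa> (k div 2)" and ?t = "(i - 1) div 2"
  have "?r < 2" by simp
  then have T: "(\<Sum>j<8. A (8 * ?r + j)) = 0"
     "(\<Sum>j<8. (if j < 4 then B else C) (8 * ?r + j)) = 0"
     "(\<Sum>j<8. (if j < 4 then C else B) (8 * ?r + j)) = 0"
     "(\<Sum>j<8. sgn_half j (D (8 * ?r + j))) = 0"
    using assms unfolding template_def sgn_half_def by blast+
  consider "i = 0" | "i \<noteq> 0" "?t = 0" "odd i" | "i \<noteq> 0" "?t = 0" "even i"
    | "i \<noteq> 0" "?t \<noteq> 0" "odd i" | "i \<noteq> 0" "?t \<noteq> 0" "even i" by blast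
  then show ?thesis
  proof cases
    case 1
    then have "rect k i j = A (8 * ?r + j) + sgn_half j ?c" for j
      by (simp add: rect_def Let_def)
    then show ?thesis by (simp add: sum.distrib T sum_sgn_half)
  next
    case 2
    then have "rect k i j = sgn_half j (u 0) + (if j < 4 then B else C) (8 * ?r + j) + sgn_half j ?c" for j
      by (simp add: rect_def Let_def sgn_half_def)
    then show ?thesis by (simp only: sum.distrib T sum_sgn_half add_0)
  next
    case 3
    then have "rect k i j = sgn_half j (- u 0) + (if j < 4 then C else B) (8 * ?r + j) + sgn_half j (- (?c + ?c))" for j
      by (simp add: rect_def Let_def sgn_half_def)
    then show ?thesis by (simp only: sum.distrib T sum_sgn_half add_0)
  next
    case 4
    then have "rect k i j = sgn_half j (u ?t) + sgn_half j (D (8 * ?r + j)) + sgn_half j ?c" for j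
      by (simp add: rect_def Let_def sgn_half_def)
    then show ?thesis by (simp only: sum.distrib T sum_sgn_half add_0)
  next
    case 5
    then have "rect k i j = - (sgn_half j (u ?t) + sgn_half j (D (8 * ?r + j)) + sgn_half j ?c)" for j
      by (simp add: rect_def Let_def sgn_half_def)
    then show ?thesis by (simp only: sum_negf sum.distrib T sum_sgn_half add_0 minus_zero)
  qed
qed

text \<open>Each coset of \<open>P + K\<close> is matched with the row and half-row that take values
  in it; solving for the component in \<open>K\<close> then determines the array.\<close>

lemma rect_surj:
  assumes T: "template P A B C D" and K: "sgrp K" "\<kappa> ` {..<n} = K" "\<And>k. k \<in> K \<Longrightarrow> \<exists>c\<in>K. c + c = k"
    and H: "sgrp (setplus P K)"
    and u: "\<And>z. z \<in> setplus P K \<or> (\<exists>t<l. z - u t \<in> setplus P K \<or> z + u t \<in> setplus P K)"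
    and l: "l \<ge> 1"
  shows "\<exists>k<2 * n. \<exists>i<2 * l + 1. \<exists>j<8. rect k i j = z"
proof -
  \<comment> \<open>The index \<open>J\<close> encodes the parity of \<open>k\<close> and the
    column, while \<open>c\<close> determines \<open>k div 2\<close> through a preimage under
    \<open>\<kappa>\<close>.\<close>
  have at: "\<exists>k<2 * n. \<exists>i<2 * l + 1. \<exists>j<8. rect k i j = z"
    if "c \<in> K" "J < 16" "i < 2 * l + 1" "\<And>k. k div 2 = m \<Longrightarrow> 8 * (k mod 2) + J mod 8 = J \<Longrightarrow> \<kappa> m = c \<Longrightarrow> rect k i (J mod 8) = z"
      "m = inv_into {..<n} \<kappa> c" for c J i m
  proof -
    have m: "m < n" "\<kappa> m = c"
      using that(1,5) K(2) inv_into_into[of c \<kappa> "{..<n}"] f_inv_into_f[of c \<kappa> "{..<n}"] by auto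
    have "J div 8 < 2" using that(2) by auto
    then have "rect (2 * m + J div 8) i (J mod 8) = z"
      using m(2) by (intro that(4)) auto
    moreover have "2 * m + J div 8 < 2 * n" using m(1) \<open>J div 8 < 2\<close> by linarith
    ultimately show ?thesis using that(3) by (metis mod_less_divisor zero_less_numeral)
  qed
  have img: "\<exists>J<16. f J = p" if "p \<in> P" "f \<in> {A, B, C, D}" for p f
    using T that by (force simp: template_def)
  have pk: "\<exists>J c. J < 16 \<and> c \<in> K \<and> y = f J + c" if "y \<in> setplus P K" "f \<in> {A, B, C, D}" for y f
    using that img by (metis setplusE)
  consider "z \<in> setplus P K" | "z - u 0 \<in> setplus P K" | "z + u 0 \<in> setplus P K"
    | t where "0 < t" "t < l" "z - u t \<in> setplus P K" | t where "0 < t" "t < l" "z + u t \<in> setplus P K"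
    using u[of z] by (metis gr0I)
  then show ?thesis
  proof cases
    case 1
    then obtain J c where Jc: "J < 16" "c \<in> K" "z = A J + c" using pk by blast
    have "sgn_half (J mod 8) c \<in> K" using Jc sgrp_minus[OF K(1)] by (simp add: sgn_half_def)
    then show ?thesis
      by (rule at[of _ J 0]) (use Jc l in \<open>auto simp: rect_def Let_def sgn_half_def\<close>)
  next
    case 2
    then obtain J c where Jc: "J < 16" "c \<in> K" "z - u 0 = B J + c" using pk by blast
    then have z: "z = u 0 + B J + c" by (simp add: algebra_simps)
    \<comment> \<open>Row 2 carries a doubled component, so reaching \<open>c\<close> there requires
      half of it.\<close>
    obtain d where d: "d \<in> K" "d + d = c" using K(3) Jc(2) by blast
    show ?thesis
    proof (cases "J mod 8 < 4")
      case True
      show ?thesis by (rule at[of c J 1]) (use True Jc z l in \<open>auto simp: rect_def Let_def sgn_half_def\<close>)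
    next
      case False
      show ?thesis by (rule at[of d J 2]) (use False Jc z l d in \<open>auto simp: rect_def Let_def sgn_half_def\<close>)
    qed
  next
    case 3
    then obtain J c where Jc: "J < 16" "c \<in> K" "z + u 0 = C J + c" using pk by blast
    then have z: "z = - u 0 + C J + c" by (simp add: algebra_simps)
    obtain d where d: "d \<in> K" "d + d = c" using K(3) Jc(2) by blast
    show ?thesis
    proof (cases "J mod 8 < 4")
      case True
      have "- d + - d = - c" using d(2) by (simp flip: d(2))
      show ?thesis
        by (rule at[of "- d" J 2]) (use True Jc z l d sgrp_minus[OF K(1)] in \<open>auto simp: rect_def Let_def sgn_half_def\<close>)
    next
      case False
      show ?thesis
        by (rule at[of "- c" J 1]) (use False Jc z l sgrp_minus[OF K(1)] in \<open>auto simp: rect_def Let_def sgn_half_def\<close>)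
    qed
  next
    case (4 t)
    then obtain J c where Jc: "J < 16" "c \<in> K" "z - u t = D J + c" using pk by blast
    then have z: "z = u t + (D J + c)" by (simp add: algebra_simps)
    show ?thesis
    proof (cases "J mod 8 < 4")
      case True
      show ?thesis by (rule at[of c J "2 * t + 1"]) (use True Jc z 4 in \<open>auto simp: rect_def Let_def\<close>)
    next
      case False
      show ?thesis by (rule at[of c J "2 * t + 2"]) (use False Jc z 4 in \<open>auto simp: rect_def Let_def\<close>)
    qed
  next
    case (5 t)
    \<comment> \<open>Entries in the coset of \<open>- u t\<close> are negatives of
      \<open>u t + (D J + c)\<close>, so the representation is sought for
      \<open>- z\<close>.\<close>
    then have "- z - u t \<in> setplus P K" using sgrp_minus[OF H 5(3)] by (simp add: algebra_simps)
    then obtain J c where Jc: "J < 16" "c \<in> K" "- z - u t = D J + c" using pk by blast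
    then have "- z = u t + (D J + c)" by (simp add: diff_eq_eq add_ac)
    then have z: "z = - (u t + (D J + c))" by (metis minus_minus)
    show ?thesis
    proof (cases "J mod 8 < 4")
      case True
      show ?thesis by (rule at[of c J "2 * t + 2"]) (use True Jc z 5 in \<open>auto simp: rect_def Let_def\<close>)
    next
      case False
      show ?thesis by (rule at[of c J "2 * t + 1"]) (use False Jc z 5 in \<open>auto simp: rect_def Let_def\<close>)
    qed
  qed
qed

end

lemma MRS_construction:
  fixes G :: "'a::{ab_group_add, finite} itself"
  assumes l: "l \<ge> 1" and card: "card (UNIV :: 'a set) = 16 * (2 * l + 1) * (2 * h + 1)"
    and inv: "card (involutions :: 'a set) > 1"
  shows "MRS_exists G (2 * l + 1) 8 (4 * h + 2)"
proof -
  have "card (UNIV :: 'a set) = 16 * ((2 * l + 1) * (2 * h + 1))" using card by (simp only: mult.assoc)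
  from template_exists[OF this inv] obtain P :: "'a set" and A B C D
    where P: "sgrp P" "card P = 16" and T: "template P A B C D" by blast
  have "2 * h + 1 dvd card (UNIV :: 'a set)" unfolding card by (rule dvd_triv_right)
  then obtain K :: "'a set" where K: "sgrp K" "card K = 2 * h + 1" using sgrp_of_card by blast
  \<comment> \<open>An element of both subgroups is annihilated by 16 and by the odd number
    \<open>2 * h + 1\<close>, hence by 1.\<close>
  have "p = 0" if "p \<in> P" "p \<in> K" for p
  proof -
    have P0: "nmul 16 p = 0" using nmul_card_sgrp[OF P(1) that(1)] P(2) by (simp only:)
    have K0: "nmul (2 * h + 1) p = 0" using nmul_card_sgrp[OF K(1) that(2)] K(2) by (simp only:)
    have "coprime (2 * h + 1) (2 ^ 4)" by (simp add: coprime_power_right_iff del: power_numeral)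
    then obtain a b where "(2 * h + 1) * a = 16 * b + 1"
      using bezout_nat[of "2 * h + 1" 16] by (auto simp: coprime_iff_gcd_eq_1)
    then have "nmul (a * (2 * h + 1)) p = nmul (b * 16 + 1) p" by (simp only: mult.commute)
    moreover have "nmul (a * (2 * h + 1)) p = 0" by (simp only: nmul_mult K0 nmul_zero)
    moreover have "nmul (b * 16 + 1) p = p"
      by (simp only: nmul_add nmul_mult P0 nmul_zero One_nat_def nmul.simps add_0 add_0_right)
    ultimately show "p = 0" by simp
  qed
  then have PK: "card (setplus P K) = 16 * (2 * h + 1)" "sgrp (setplus P K)"
    using card_setplus[OF P(1) K(1)] sgrp_setplus[OF P(1) K(1)] P(2) K(2) by auto
  then have "card (UNIV :: 'a set) = card (setplus P K) * (2 * l + 1)"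
    using card by (simp only: mult_ac)
  then obtain u :: "nat \<Rightarrow> 'a" where
    u: "\<And>x. x \<in> setplus P K \<or> (\<exists>i<l. x - u i \<in> setplus P K \<or> x + u i \<in> setplus P K)"
    using symmetric_representatives[OF PK(2)] by blast
  obtain \<kappa> where "bij_betw \<kappa> {0..<2 * h + 1} K"
    using ex_bij_betw_nat_finite[of K] K(2) by auto
  then have \<kappa>: "\<kappa> ` {..<2 * h + 1} = K" by (simp add: bij_betw_def lessThan_atLeast0)
  let ?R = "rect A B C D u \<kappa>"
  let ?X = "{..<4 * h + 2} \<times> {..<2 * l + 1} \<times> {..<8 :: nat}"
  have "z \<in> (\<lambda>(k, i, j). ?R k i j) ` ?X" for z
  proof -
    obtain k i j where "k < 2 * (2 * h + 1)" "i < 2 * l + 1" "j < 8" "?R k i j = z"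
      using rect_surj[OF T K(1) \<kappa> odd_sgrp_halves[OF K] PK(2) u l, of z] by blast
    then show ?thesis by (intro rev_image_eqI[of "(k, i, j)"]) auto
  qed
  then have surj: "(\<lambda>(k, i, j). ?R k i j) ` ?X = UNIV" by blast
  \<comment> \<open>There are as many cells as group elements, so surjectivity already gives
    bijectivity.\<close>
  moreover have "card ?X = card (UNIV :: 'a set)"
    using card by (simp add: card_cartesian_product algebra_simps)
  ultimately have "inj_on (\<lambda>(k, i, j). ?R k i j) ?X"
    by (intro eq_card_imp_inj_on) auto
  with surj have "bij_betw (\<lambda>(k, i, j). ?R k i j) ?X UNIV" by (simp add: bij_betw_def)
  then have "is_MRS (2 * l + 1) 8 (4 * h + 2) ?R"
    unfolding is_MRS_def using rect_row_sum[OF T] rect_column_sum[OF T _ l] by blast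
  then show ?thesis unfolding MRS_exists_def by blast
qed

section \<open>Necessity of two involutions\<close>

text \<open>The elements cancel in pairs \<open>x\<close>, \<open>- x\<close>, which are distinct
  because \<open>x + x\<close> is nonzero.\<close>

lemma sum_uminus_closed:
  fixes S :: "'a::ab_group_add set"
  assumes "finite S" "\<And>x. x \<in> S \<Longrightarrow> - x \<in> S \<and> x + x \<noteq> 0"
  shows "\<Sum>S = 0"
  using assms
proof (induction "card S" arbitrary: S rule: less_induct)
  case less
  show ?case
  proof (cases "S = {}")
    case False
    then obtain x where x: "x \<in> S" by blast
    then have ne: "- x \<in> S" "- x \<noteq> x" using less.prems(2) by (auto simp: minus_equation_iff) (metis add.right_inverse)
    let ?S = "S - {x, - x}"
    have "card ?S < card S" using x less.prems(1) by (intro psubset_card_mono) auto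
    moreover have "- y \<in> ?S \<and> y + y \<noteq> 0" if "y \<in> ?S" for y
      using that less.prems(2)[of y] by (auto simp: minus_equation_iff)
    ultimately have "\<Sum>?S = 0" using less.hyps less.prems(1) by blast
    moreover have "\<Sum>S = \<Sum>?S + \<Sum>{x, - x}"
      using x ne less.prems(1) by (intro sum.subset_diff) auto
    ultimately show ?thesis using ne by simp
  qed simp
qed

lemma sum_UNIV_eq_sum_involutions:
  "\<Sum>(UNIV :: 'a::{ab_group_add, finite} set) = \<Sum>involutions"
proof -
  let ?S = "{x :: 'a. x + x \<noteq> 0}"
  have "\<Sum>?S = 0"
  proof (rule sum_uminus_closed)
    fix x :: 'a assume "x \<in> ?S"
    then have "x + x \<noteq> 0" by simp
    moreover from this have "- (x + x) \<noteq> 0" by (simp only: neg_equal_0_iff_equal not_False_eq_True)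
    ultimately show "- x \<in> ?S \<and> x + x \<noteq> 0" by (simp add: algebra_simps)
  qed simp
  moreover have "\<Sum>(UNIV :: 'a set) = \<Sum>(UNIV - ?S) + \<Sum>?S"
    by (rule sum.subset_diff) auto
  moreover have "\<Sum>(UNIV - ?S) = \<Sum>involutions"
    by (rule sum.mono_neutral_right) (auto simp: involutions_def)
  ultimately show ?thesis by simp
qed

lemma MRS_imp_involutions:
  fixes G :: "'a::{ab_group_add, finite} itself"
  assumes card: "card (UNIV :: 'a set) = 16 * (2 * l + 1) * (2 * h + 1)"
    and MRS: "MRS_exists G (2 * l + 1) 8 (4 * h + 2)"
  shows "card (involutions :: 'a set) > 1"
proof (rule ccontr)
  assume "\<not> ?thesis"
  \<comment> \<open>The group order is even, so Cauchy's theorem yields an involution.\<close>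
  moreover have "card (involutions :: 'a set) \<noteq> 0"
  proof -
    have "sgrp {0 :: 'a}" by (simp add: sgrp_def)
    from cauchy_quotient[OF this two_is_prime_nat] obtain g :: 'a where "g \<noteq> 0" "g + g = 0"
      using card by auto
    then show ?thesis by (auto simp: involutions_def)
  qed
  ultimately have "card (involutions :: 'a set) = 1" by linarith
  then obtain z :: 'a where z: "involutions = {z}" using card_1_singletonE by blast
  then have zz: "z \<noteq> 0" "z + z = 0" by (auto simp: involutions_def)
  obtain R :: "nat \<Rightarrow> nat \<Rightarrow> nat \<Rightarrow> 'a" and \<delta> where
    bij: "bij_betw (\<lambda>(k, i, j). R k i j) ({..<4 * h + 2} \<times> {..<2 * l + 1} \<times> {..<8}) UNIV" and
    col: "\<And>k j. k < 4 * h + 2 \<Longrightarrow> j < 8 \<Longrightarrow> (\<Sum>i<2 * l + 1. R k i j) = \<delta>"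
    using MRS unfolding MRS_exists_def is_MRS_def by blast
  have "z = \<Sum>(UNIV :: 'a set)" by (simp add: sum_UNIV_eq_sum_involutions z)
  also have "\<dots> = (\<Sum>(k, i, j)\<in>{..<4 * h + 2} \<times> {..<2 * l + 1} \<times> {..<8}. R k i j)"
    using sum.reindex_bij_betw[OF bij, of "\<lambda>x. x"] by (simp add: case_prod_unfold)
  also have "\<dots> = (\<Sum>k<4 * h + 2. \<Sum>i<2 * l + 1. \<Sum>j<8. R k i j)"
    by (simp only: sum.cartesian_product)
  also have "\<dots> = (\<Sum>k<4 * h + 2. \<Sum>j<8. \<Sum>i<2 * l + 1. R k i j)"
    by (intro sum.cong refl sum.swap)
  also have "\<dots> = (\<Sum>k<4 * h + 2. \<Sum>j<8::nat. \<delta>)" by (intro sum.cong refl col) simp_all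
  also have "\<dots> = nmul ((4 * h + 2) * 8) \<delta>"
    by (simp only: sum_constant_nmul finite_lessThan card_lessThan nmul_mult)
  \<comment> \<open>Multiplication by \<open>2 * l + 1\<close> turns the coefficient of
    \<open>\<delta>\<close> into the group order, while the left side is still \<open>z\<close>,
    being an odd multiple.\<close>
  finally have "nmul (2 * l + 1) z = nmul ((2 * l + 1) * ((4 * h + 2) * 8)) \<delta>"
    by (simp only: nmul_mult)
  also have "(2 * l + 1) * ((4 * h + 2) * 8) = card (UNIV :: 'a set)"
    unfolding card by (simp add: algebra_simps)
  also have "nmul (card (UNIV :: 'a set)) \<delta> = 0"
    by (rule nmul_card_sgrp) (simp_all add: sgrp_def)
  finally have "nmul (2 * l) z + z = 0" by (simp add: add.commute)
  moreover have "nmul (2 * l) z = 0"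
    using zz(2) nmul_mult[of l 2 z] by (simp add: mult.commute)
  ultimately show False using zz(1) by simp
qed

theorem theorem1p8:
  fixes l h :: nat
    and G :: "'a::{ab_group_add, finite} itself"
  assumes "l \<ge> 1"
    and "card (UNIV :: 'a set) = 16 * (2 * l + 1) * (2 * h + 1)"
  shows "MRS_exists G (2 * l + 1) 8 (4 * h + 2) \<longleftrightarrow> card (involutions :: 'a set) > 1"
  using MRS_construction[OF assms] MRS_imp_involutions[OF assms(2)] by blast

end
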